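(* Let $f_1,\dots,f_m:\mathbb{R}^n\to\mathbb{R}$ be convex, let $F(x)=\sum_{i=1}^m f_i(x_i)$ for $x=[x_1^T,\dots,x_m^T]^T\in\mathbb{R}^{mn}$, and let $W=\bar W\otimes I_n$, where $\bar W$ is the Laplacian of a fixed connected undirected graph on $m$ nodes. Assume that $F$ is dual-friendly, convex and $L$-smooth. Let $\varepsilon>0$, let $c=x^*(z_0)$ be the primal point associated with the dual starting point $z_0=0$, let $x^*$ be the solution of $\min_{\sqrt W x=0}F(x)$ closest to $c$, let $R_x=\|x^*-c\|_2$, and let $R<\infty$ be the smallest Euclidean norm of a minimizer of the dual function $\varphi$. Set $\mu=\varepsilon/R_x^2$ and $F^\mu(x)=F(x)+\frac{\mu}{2}\|x-c\|_2^2$. Then, after $$N=\tilde O\left(\sqrt{\frac{LR_x^2}{\varepsilon}\,\chi(W)}\right)$$ iterations (oracle calls) of the distributed fast gradient method applied to the dual problem of the regularized problem $\min_{\sqrt W x=0}F^\mu(x)$, the point $x^*(z_N)$ (the primal point associated with $z_N$ for the regularized function $F^\mu$) is an $(\varepsilon,\varepsilon/R)$-optimal solution of the problem $\min_{\sqrt W x=0}F(x)$.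
   Context: All norms are Euclidean. The Laplacian $\bar W\in\mathbb{R}^{m\times m}$ of a graph $\mathcal G=(V,E)$ with $|V|=m$ is $[\bar W]_{ij}=-1$ if $(i,j)\in E$, $[\bar W]_{ii}=\deg(i)$, and $0$ otherwise. The matrix $W=\bar W\otimes I_n$ is symmetric positive semidefinite, $\sqrt W$ is its positive semidefinite square root, and $\sqrt W x=0$ if and only if $x_1=\dots=x_m$. $\lambda_{\max}(W)$ and $\lambda_{\min}^+(W)$ denote the largest and the smallest nonzero eigenvalue of $W$, and $\chi(W)=\lambda_{\max}(W)/\lambda_{\min}^+(W)$. $F$ is $L$-smooth if it is differentiable with $\|\nabla F(x)-\nabla F(y)\|_2\le L\|x-y\|_2$ for all $x,y$. The dual function of $F$ is $\varphi(y)=\max_{x}\{\langle\sqrt W y,x\rangle-F(x)\}$ for $y\in\mathbb{R}^{mn}$. $R=\|y^*\|_2$, where $y^*$ is the minimizer of $\varphi$ of smallest norm; it is assumed throughout that $R<\infty$. The primal point associated with $z\in\mathbb{R}^{mn}$ for a function $H$ is $\arg\max_x\{\langle z,x\rangle-H(x)\}$. In particular $c=x^*(z_0)$ with $z_0=0$ is a minimizer of $F$ over $\mathbb{R}^{mn}$ (equivalently, the minimizer of $F^\mu$). In the iteration below $x^*(z)=\arg\max_x\{\langle z,x\rangle-F^\mu(x)\}$, which splits into blocks $x_j^*(z^j)=\arg\max_{x_j\in\mathbb{R}^n}\{\langle z^j,x_j\rangle-f_j(x_j)-\frac{\mu}{2}\|x_j-c_j\|_2^2\}$. Dual-friendly means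 that these maximizers are available explicitly (or can be computed efficiently), so they are treated as returned exactly by an oracle; one iteration is one oracle call. Distributed fast gradient method on the dual of $F^\mu$: with $L_\varphi=\lambda_{\max}(W)/\mu$ and $\mu_\varphi=\lambda_{\min}^+(W)/(L+\mu)$, start from $z_0=\tilde z_0=0$ and let each node $i$ compute $$z_{k+1}^i=\tilde z_k^i-\frac{1}{L_\varphi}\sum_{j=1}^m W_{ij}x_j^*(\tilde z_k^j),\qquad \tilde z_{k+1}^i=z_{k+1}^i+\frac{\sqrt{L_\varphi}-\sqrt{\mu_\varphi}}{\sqrt{L_\varphi}+\sqrt{\mu_\varphi}}(z_{k+1}^i-z_k^i),$$ with $W_{ij}=[\bar W]_{ij}\otimes I_n$. This is Nesterov's fast gradient method on the dual function $y\mapsto\max_x\{\langle\sqrt W y,x\rangle-F^\mu(x)\}$ in the variables $z_k=\sqrt W y_k$, $\tilde z_k=\sqrt W\tilde y_k$. A point $\hat x$ is an $(\varepsilon,\tilde\varepsilon)$-optimal solution of $\min_{\sqrt W x=0}F(x)$ if $F(\hat x)-F(x^* )\le\varepsilon$ and $\|\sqrt W\hat x\|_2\le\tilde\varepsilon$. The notation $\tilde O$ hides universal constants and factors logarithmic in the problem parameters.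
   Formalization: In the iteration bound LR_x²/ε is replaced by max(1, LR_x²/ε), since the literal bound can fail when ε > LR_x²; R_x > 0 is assumed so that μ is defined, and ε/R is read as infinite if R = 0. *)

theory Defs
  imports "HOL-Analysis.Analysis"
begin

text \<open>
  The nodes are the elements of a finite type \<open>'m\<close>, local variables live in \<open>real^'n\<close>, and
  stacked vectors live in \<open>real^('m \<times> 'n)\<close>; entry \<open>(i, k)\<close> is coordinate \<open>k\<close> of block \<open>i\<close>.
\<close>

definition simple_graph :: "('m \<times> 'm) set \<Rightarrow> bool" where
  "simple_graph E \<longleftrightarrow> sym E \<and> irrefl E"

definition connected_graph :: "('m \<times> 'm) set \<Rightarrow> bool" where
  "connected_graph E \<longleftrightarrow> (\<forall>i j. (i, j) \<in> E\<^sup>*)"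

definition laplacian :: "('m::finite \<times> 'm) set \<Rightarrow> real^'m^'m" where
  "laplacian E = (\<chi> i j. if i = j then real (card {k. (i, k) \<in> E})
                         else if (i, j) \<in> E then -1 else 0)"

definition kronecker ::
  "real^'m^'m \<Rightarrow> real^'n^'n \<Rightarrow> real^('m::finite \<times> 'n::finite)^('m \<times> 'n)" where
  "kronecker A B = (\<chi> p q. A $ fst p $ fst q * B $ snd p $ snd q)"

definition block :: "real^('m::finite \<times> 'n::finite) \<Rightarrow> 'm \<Rightarrow> real^'n" where
  "block x i = (\<chi> k. x $ (i, k))"

definition stack :: "('m::finite \<Rightarrow> real^'n::finite) \<Rightarrow> real^('m \<times> 'n)" where
  "stack v = (\<chi> p. v (fst p) $ snd p)"

definition mat_block :: "real^('m::finite \<times> 'n::finite)^('m \<times> 'n) \<Rightarrow> 'm \<Rightarrow> 'm \<Rightarrow> real^'n^'n" where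
  "mat_block W i j = (\<chi> k l. W $ (i, k) $ (j, l))"

definition eigenvalue :: "real^'a^'a \<Rightarrow> real \<Rightarrow> bool" where
  "eigenvalue A l \<longleftrightarrow> (\<exists>v. v \<noteq> 0 \<and> A *v v = l *\<^sub>R v)"

definition lambda_max :: "real^'a^'a \<Rightarrow> real" where
  "lambda_max A = Max {l. eigenvalue A l}"

definition lambda_min_nz :: "real^'a^'a \<Rightarrow> real" where
  "lambda_min_nz A = Min {l. eigenvalue A l \<and> l \<noteq> 0}"

definition cond_number :: "real^'a^'a \<Rightarrow> real" where
  "cond_number A = lambda_max A / lambda_min_nz A"

definition is_psd_sqrt :: "real^'a^'a \<Rightarrow> real^'a^'a \<Rightarrow> bool" where
  "is_psd_sqrt S A \<longleftrightarrow> transpose S = S \<and> (\<forall>x. 0 \<le> x \<bullet> (S *v x)) \<and> S ** S = A"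

definition L_smooth :: "real \<Rightarrow> ('a::real_inner \<Rightarrow> real) \<Rightarrow> bool" where
  "L_smooth L F \<longleftrightarrow>
     (\<exists>g. (\<forall>x. GDERIV F x :> g x) \<and> (\<forall>x y. norm (g x - g y) \<le> L * norm (x - y)))"

definition separable_sum :: "('m::finite \<Rightarrow> real^'n::finite \<Rightarrow> real) \<Rightarrow> real^('m \<times> 'n) \<Rightarrow> real" where
  "separable_sum f x = (\<Sum>i\<in>UNIV. f i (block x i))"

definition regularize :: "real \<Rightarrow> 'a::real_inner \<Rightarrow> ('a \<Rightarrow> real) \<Rightarrow> 'a \<Rightarrow> real" where
  "regularize \<mu> c H x = H x + \<mu> / 2 * (norm (x - c))\<^sup>2"

text \<open>A relation rather than a function, since the maximizer need not be unique for general \<open>H\<close>.\<close>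

definition is_primal_point :: "('a::real_inner \<Rightarrow> real) \<Rightarrow> 'a \<Rightarrow> 'a \<Rightarrow> bool" where
  "is_primal_point H z x \<longleftrightarrow> is_arg_max (\<lambda>x. z \<bullet> x - H x) (\<lambda>_. True) x"

text \<open>
  Extended-real valued: without strong convexity of \<open>F\<close> the supremum can be infinite.  It is
  attained at every minimizer of the dual function whenever the primal problem has a solution.
\<close>

definition dual_fun :: "(real^'a \<Rightarrow> real) \<Rightarrow> real^'a^'a \<Rightarrow> real^'a \<Rightarrow> ereal" where
  "dual_fun F S y = (SUP x. ereal ((S *v y) \<bullet> x - F x))"

definition is_solution :: "(real^'a \<Rightarrow> real) \<Rightarrow> real^'a^'a \<Rightarrow> real^'a \<Rightarrow> bool" where
  "is_solution F S x \<longleftrightarrow> is_arg_min F (\<lambda>x. S *v x = 0) x"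

text \<open>
  The feasibility tolerance \<open>\<delta>\<close> is extended real so that the tolerance \<open>\<epsilon>/R\<close> is infinite, rather
  than \<open>0\<close>, when \<open>R = 0\<close>; \<open>xs\<close> is any solution of the constrained problem.
\<close>

definition approx_optimal ::
  "(real^'a \<Rightarrow> real) \<Rightarrow> real^'a^'a \<Rightarrow> real^'a \<Rightarrow> real \<Rightarrow> ereal \<Rightarrow> real^'a \<Rightarrow> bool" where
  "approx_optimal F S xs \<epsilon> \<delta> x \<longleftrightarrow> F x - F xs \<le> \<epsilon> \<and> ereal (norm (S *v x)) \<le> \<delta>"

text \<open>
  State after \<open>k\<close> iterations: the pair of the families \<open>z\<^sub>k\<close> and \<open>zt\<^sub>k\<close> (the extrapolated points), indexed by
  the nodes; \<open>orc j\<close> is the local oracle of node \<open>j\<close>.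
\<close>

primrec dual_fgm ::
  "real^('m::finite \<times> 'n::finite)^('m \<times> 'n) \<Rightarrow> ('m \<Rightarrow> real^'n \<Rightarrow> real^'n) \<Rightarrow> real \<Rightarrow> real
     \<Rightarrow> nat \<Rightarrow> ('m \<Rightarrow> real^'n) \<times> ('m \<Rightarrow> real^'n)" where
  "dual_fgm W orc L\<phi> \<mu>\<phi> 0 = ((\<lambda>_. 0), (\<lambda>_. 0))"
| "dual_fgm W orc L\<phi> \<mu>\<phi> (Suc k) =
     (let z = fst (dual_fgm W orc L\<phi> \<mu>\<phi> k);
          zt = snd (dual_fgm W orc L\<phi> \<mu>\<phi> k);
          z' = (\<lambda>i. zt i - (1 / L\<phi>) *\<^sub>R (\<Sum>j\<in>UNIV. mat_block W i j *v orc j (zt j)))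
      in (z', (\<lambda>i. z' i + ((sqrt L\<phi> - sqrt \<mu>\<phi>) / (sqrt L\<phi> + sqrt \<mu>\<phi>)) *\<^sub>R (z' i - z i))))"

text \<open>
  A concrete representative of the class of bounds written \<open>O~(G)\<close>.  The constant is numeric,
  hence independent of the dimensions, which are types here (an existentially quantified constant
  could depend on them).
\<close>

definition soft_O_bound :: "real \<Rightarrow> real" where
  "soft_O_bound G = 50 * G * ln (exp 1 + G)"

end

theory Submission
  imports Defs
begin

text \<open>
  Since \<open>F\<^sup>\<mu>\<close> is \<open>\<mu>\<close>-strongly convex and \<open>(L + \<mu>)\<close>-smooth, the regularized dual function \<open>\<phi>\<close> is
  \<open>L\<phi>\<close>-smooth and, on the range of \<open>S = \<surd>W\<close>, \<open>\<mu>\<phi>\<close>-strongly convex; the iterates \<open>y\<^sub>k\<close> with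
  \<open>z\<^sub>k = S y\<^sub>k\<close> never leave that range, so the fast gradient method drives the dual gap \<open>\<delta>\<close> to zero
  at rate \<open>1 - \<surd>(\<mu>\<phi>/L\<phi>)\<close>.  The infeasibility of \<open>x = x\<^sup>*(S y)\<close> is the dual gradient norm
  \<open>\<parallel>S x\<parallel> \<le> \<surd>(2 L\<phi> \<delta>)\<close>, and \<open>F\<^sup>\<mu>(x) - min F\<^sup>\<mu> = \<langle>y, S x\<rangle> - \<delta> \<le> \<parallel>y\<parallel> \<parallel>S x\<parallel>\<close>.  Everything else is
  an a priori bound: \<open>R\<close>, the norm of the regularized dual solution and the initial gap are all
  controlled by \<open>L\<close>, \<open>Rx\<close> and the smallest nonzero eigenvalue of \<open>W\<close>, because \<open>c\<close> is an
  unconstrained minimizer of \<open>F\<close>.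
\<close>

section \<open>Convexity, smoothness and conjugates\<close>

text \<open>The Bregman divergence, with the gradient field as a parameter. Convexity, strong
  convexity and smoothness all become one-sided bounds on it.\<close>

definition bregman :: "('a::real_inner \<Rightarrow> real) \<Rightarrow> ('a \<Rightarrow> 'a) \<Rightarrow> 'a \<Rightarrow> 'a \<Rightarrow> real" where
  "bregman H G y x = H y - H x - G x \<bullet> (y - x)"

lemma norm_diff_scaleR_squared:
  fixes x y :: "'a::real_inner"
  shows "(norm (x - t *\<^sub>R y))\<^sup>2 = (norm x)\<^sup>2 - 2 * t * (x \<bullet> y) + t\<^sup>2 * (norm y)\<^sup>2"
  unfolding power2_norm_eq_inner
  by (simp add: inner_diff_left inner_diff_right inner_commute power2_eq_square)

lemma norm_convex_combination_squared:
  fixes x y :: "'a::real_inner"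
  shows "(norm ((1 - t) *\<^sub>R x + t *\<^sub>R y))\<^sup>2
    = (1 - t) * (norm x)\<^sup>2 + t * (norm y)\<^sup>2 - t * (1 - t) * (norm (x - y))\<^sup>2"
  unfolding power2_norm_eq_inner
  by (simp add: inner_add_left inner_add_right inner_diff_left inner_diff_right inner_commute[of y x])
    algebra

lemma GDERIV_along_line:
  fixes F :: "'a::real_inner \<Rightarrow> real"
  assumes "GDERIV F (x + t *\<^sub>R d) :> g"
  shows "DERIV (\<lambda>t. F (x + t *\<^sub>R d)) t :> g \<bullet> d"
proof -
  have "((\<lambda>t. x + t *\<^sub>R d) has_derivative (\<lambda>h. h *\<^sub>R d)) (at t)"
    by (auto intro!: derivative_eq_intros)
  then have "((\<lambda>t. F (x + t *\<^sub>R d)) has_derivative (\<lambda>h. (h *\<^sub>R d) \<bullet> g)) (at t)"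
    using assms has_derivative_compose unfolding gderiv_def by fast
  then show ?thesis
    by (auto simp: has_field_derivative_def inner_commute mult.commute elim!: has_derivative_eq_rhs)
qed

lemma bregman_nonneg_if_convex:
  fixes F :: "'a::real_inner \<Rightarrow> real"
  assumes "convex_on UNIV F" and "GDERIV F x :> g x"
  shows "0 \<le> bregman F g y x"
proof -
  let ?h = "\<lambda>t. F (x + t *\<^sub>R (y - x))"
  have eq: "x + ((1 - u) * s + u * t) *\<^sub>R (y - x)
      = (1 - u) *\<^sub>R (x + s *\<^sub>R (y - x)) + u *\<^sub>R (x + t *\<^sub>R (y - x))" for s t u
    by (simp add: algebra_simps)
  have "convex_on UNIV ?h"
  proof (rule convex_onI)
    fix u s t :: real
    assume "0 < u" "u < 1"
    then show "?h ((1 - u) *\<^sub>R s + u *\<^sub>R t) \<le> (1 - u) * ?h s + u * ?h t"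
      using convex_onD[OF assms(1), of u "x + s *\<^sub>R (y - x)" "x + t *\<^sub>R (y - x)"]
      by (simp add: eq)
  qed simp
  moreover have "DERIV ?h 0 :> g x \<bullet> (y - x)"
    by (rule GDERIV_along_line) (simp add: assms(2))
  ultimately have "?h 1 - ?h 0 \<ge> (g x \<bullet> (y - x)) * (1 - 0)"
    by (intro convex_on_imp_above_tangent[of UNIV]) auto
  then show ?thesis by (simp add: bregman_def)
qed

text \<open>The descent lemma without integration: along the segment, \<open>F\<close> minus its
  tangent and the quadratic has nonpositive derivative.\<close>

lemma bregman_le_if_lipschitz_gradient:
  fixes F :: "'a::real_inner \<Rightarrow> real"
  assumes g: "\<And>x. GDERIV F x :> g x"
    and lip: "\<And>x y. norm (g x - g y) \<le> L * norm (x - y)"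
  shows "bregman F g y x \<le> L / 2 * (norm (y - x))\<^sup>2"
proof -
  define d where "d = y - x"
  let ?h = "\<lambda>t. F (x + t *\<^sub>R d) - t * (g x \<bullet> d) - L / 2 * t\<^sup>2 * (norm d)\<^sup>2"
  have "?h 1 \<le> ?h 0"
  proof (rule DERIV_nonpos_imp_nonincreasing[OF zero_le_one])
    fix t :: real
    assume t: "0 \<le> t" "t \<le> 1"
    have "DERIV ?h t :> g (x + t *\<^sub>R d) \<bullet> d - g x \<bullet> d - L * t * (norm d)\<^sup>2"
      by (auto intro!: derivative_eq_intros GDERIV_along_line[OF g])
    moreover have "(g (x + t *\<^sub>R d) - g x) \<bullet> d \<le> (L * (t * norm d)) * norm d"
      using lip[of "x + t *\<^sub>R d" x] t
      by (intro order_trans[OF norm_cauchy_schwarz mult_right_mono]) auto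
    ultimately show "\<exists>D. DERIV ?h t :> D \<and> D \<le> 0"
      by (intro exI[of _ "g (x + t *\<^sub>R d) \<bullet> d - g x \<bullet> d - L * t * (norm d)\<^sup>2"])
        (simp add: inner_diff_left power2_eq_square mult_ac)
  qed
  then show ?thesis by (simp add: d_def bregman_def)
qed

text \<open>The quadratic contributes its exact second-order remainder, free of \<open>c\<close>, so
  both curvature bounds of \<open>F\<close> shift by \<open>\<mu>\<close>.\<close>

lemma regularize_bregman:
  fixes c :: "'a::real_inner"
  shows "bregman (regularize \<mu> c F) (\<lambda>x. g x + \<mu> *\<^sub>R (x - c)) y x
    = bregman F g y x + \<mu> / 2 * (norm (y - x))\<^sup>2"
proof -
  have "(norm (y - c))\<^sup>2 = (norm (x - c))\<^sup>2 + 2 * ((x - c) \<bullet> (y - x)) + (norm (y - x))\<^sup>2"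
    by (simp add: power2_norm_eq_inner inner_commute algebra_simps)
  then have "\<mu> / 2 * (norm (y - c))\<^sup>2 = \<mu> / 2 * (norm (x - c))\<^sup>2
      + \<mu> * ((x - c) \<bullet> (y - x)) + \<mu> / 2 * (norm (y - x))\<^sup>2"
    by (simp add: field_simps)
  then show ?thesis
    by (simp only: regularize_def bregman_def inner_add_left inner_scaleR_left)
qed

text \<open>Moving along \<open>k\<close> to the minimizer of the quadratic upper bound would
  decrease \<open>H\<close> unless the slope vanishes.\<close>

lemma gradient_orthogonal_at_minimizer:
  fixes H :: "'a::real_inner \<Rightarrow> real"
  assumes K: "subspace K" and M: "M > 0"
    and sm: "\<And>y. bregman H G y x \<le> M / 2 * (norm (y - x))\<^sup>2"
    and min: "\<And>k. k \<in> K \<Longrightarrow> H x \<le> H (x + k)" and k: "k \<in> K"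
  shows "G x \<bullet> k = 0"
proof (cases "k = 0")
  case False
  define t where "t = (G x \<bullet> k) / (M * (norm k)\<^sup>2)"
  have "(- t) *\<^sub>R k \<in> K" using K k subspace_scale by blast
  from min[OF this] sm[of "x + (- t) *\<^sub>R k"]
  have "0 \<le> M / 2 * (t * norm k)\<^sup>2 - t * (G x \<bullet> k)"
    by (simp add: bregman_def power_mult_distrib)
  also have "\<dots> = - ((G x \<bullet> k)\<^sup>2 / (2 * M * (norm k)\<^sup>2))"
    using False M by (simp add: t_def power2_eq_square field_simps)
  finally have "(G x \<bullet> k)\<^sup>2 / (2 * M * (norm k)\<^sup>2) \<le> 0" by simp
  then show ?thesis using False M
    by (simp add: divide_le_0_iff mult_le_0_iff)
qed simp

lemma is_primal_point_iff:
  "is_primal_point H z x \<longleftrightarrow> (\<forall>y. z \<bullet> y - H y \<le> z \<bullet> x - H x)"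
  by (auto simp: is_primal_point_def is_arg_max_linorder)

text \<open>Subtracting \<open>z \<bullet> y\<close> leaves the divergence unchanged, so
  stationarity applies on the whole space, tested in the direction \<open>G x - z\<close>.\<close>

lemma gradient_at_primal_point:
  fixes H :: "'a::real_inner \<Rightarrow> real"
  assumes M: "M > 0" and sm: "\<And>y. bregman H G y x \<le> M / 2 * (norm (y - x))\<^sup>2"
    and x: "is_primal_point H z x"
  shows "G x = z"
proof -
  have "bregman (\<lambda>y. H y - z \<bullet> y) (\<lambda>y. G y - z) y x = bregman H G y x" for y
    by (simp add: bregman_def algebra_simps)
  moreover have "H x - z \<bullet> x \<le> H (x + k) - z \<bullet> (x + k)" for k
    using x[unfolded is_primal_point_iff, rule_format, of "x + k"] by simp
  ultimately have "(G x - z) \<bullet> (G x - z) = 0"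
    using gradient_orthogonal_at_minimizer
      [of UNIV M "\<lambda>y. H y - z \<bullet> y" "\<lambda>y. G y - z" x "G x - z"] M sm by simp
  then show ?thesis by simp
qed

lemma primal_point_if_gradient:
  fixes H :: "'a::real_inner \<Rightarrow> real"
  assumes "\<And>y. 0 \<le> bregman H G y x" and "G x = z"
  shows "is_primal_point H z x"
  unfolding is_primal_point_iff
proof
  show "z \<bullet> y - H y \<le> z \<bullet> x - H x" for y
    using assms(1)[of y] assms(2) by (simp add: bregman_def algebra_simps)
qed

lemma primal_point_unique:
  fixes H :: "'a::real_inner \<Rightarrow> real"
  assumes mu: "\<mu> > 0" and sc: "\<And>y. \<mu> / 2 * (norm (y - x))\<^sup>2 \<le> bregman H G y x"
    and G: "G x = z" and y: "is_primal_point H z y"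
  shows "y = x"
proof -
  have "z \<bullet> x - H x \<le> z \<bullet> y - H y"
    using y by (simp add: is_primal_point_iff)
  with sc[of y] have "\<mu> / 2 * (norm (y - x))\<^sup>2 \<le> 0"
    by (simp add: bregman_def G algebra_simps)
  then show ?thesis using mu by (simp add: mult_le_0_iff)
qed

text \<open>The convex conjugate of \<open>H\<close> when \<open>X z\<close> is a primal point for every \<open>z\<close>, with gradient \<open>X\<close>.\<close>

definition conjugate_via :: "('a::real_inner \<Rightarrow> real) \<Rightarrow> ('a \<Rightarrow> 'a) \<Rightarrow> 'a \<Rightarrow> real" where
  "conjugate_via H X z = z \<bullet> X z - H (X z)"

text \<open>The quadratic upper model of \<open>H\<close> at \<open>X z\<close> conjugates to a
  quadratic lower model of the conjugate at \<open>z\<close>.\<close>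

lemma conjugate_strongly_convex:
  fixes H :: "'a::real_inner \<Rightarrow> real"
  assumes M: "M > 0" and sm: "\<And>x y. bregman H G y x \<le> M / 2 * (norm (y - x))\<^sup>2"
    and X: "\<And>z. is_primal_point H z (X z)"
  shows "1 / (2 * M) * (norm (w - z))\<^sup>2 \<le> bregman (conjugate_via H X) X w z"
proof -
  \<comment> \<open>The maximizer of \<open>w \<bullet> x\<close> minus the upper model:
    stationarity reads \<open>w - z = M (x - X z)\<close>.\<close>
  define x where "x = X z + (1 / M) *\<^sub>R (w - z)"
  have "G (X z) = z" using gradient_at_primal_point[OF M sm X] .
  then have "H x \<le> H (X z) + z \<bullet> (x - X z) + M / 2 * (norm (x - X z))\<^sup>2"
    using sm[of x "X z"] by (simp add: bregman_def)
  also have "M / 2 * (norm (x - X z))\<^sup>2 = 1 / (2 * M) * (norm (w - z))\<^sup>2"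
  proof -
    have "norm (x - X z) = 1 / M * norm (w - z)" using M by (simp add: x_def)
    then show ?thesis using M by (simp only:) (simp add: power2_eq_square)
  qed
  finally have "H x \<le> H (X z) + z \<bullet> (x - X z) + 1 / (2 * M) * (norm (w - z))\<^sup>2" .
  moreover have "w \<bullet> x - H x \<le> w \<bullet> X w - H (X w)"
    using X[of w] by (simp add: is_primal_point_iff)
  moreover have "(w - z) \<bullet> (x - X z) = 2 * (1 / (2 * M) * (norm (w - z))\<^sup>2)"
    using M by (simp add: x_def power2_norm_eq_inner)
  ultimately show ?thesis
    by (simp add: conjugate_via_def bregman_def inner_diff_left inner_diff_right inner_commute)
qed

text \<open>Strong convexity of \<open>H\<close> bounds the divergence by
  \<open>(w - z) \<bullet> d - \<mu>/2 \<parallel>d\<parallel>^2\<close>; completing the square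
  removes \<open>d\<close>.\<close>

lemma conjugate_smooth:
  fixes H :: "'a::real_inner \<Rightarrow> real"
  assumes mu: "\<mu> > 0" and sc: "\<And>x y. \<mu> / 2 * (norm (y - x))\<^sup>2 \<le> bregman H G y x"
    and G: "\<And>z. G (X z) = z"
  shows "bregman (conjugate_via H X) X w z \<le> 1 / (2 * \<mu>) * (norm (w - z))\<^sup>2"
proof -
  define d where "d = X w - X z"
  have "0 \<le> 1 / (2 * \<mu>) * (norm (w - z - \<mu> *\<^sub>R d))\<^sup>2"
    using mu by simp
  also have "\<dots> = 1 / (2 * \<mu>) * (norm (w - z))\<^sup>2 - (w - z) \<bullet> d + \<mu> / 2 * (norm d)\<^sup>2"
    using mu unfolding norm_diff_scaleR_squared by (simp add: field_simps power2_eq_square)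
  finally have "(w - z) \<bullet> d - \<mu> / 2 * (norm d)\<^sup>2 \<le> 1 / (2 * \<mu>) * (norm (w - z))\<^sup>2"
    by simp
  then show ?thesis
    using sc[of "X w" "X z"] G[of z]
    by (simp add: conjugate_via_def bregman_def d_def
        inner_diff_left inner_diff_right inner_commute)
qed

text \<open>Growth makes the sublevel set of \<open>H k\<close> bounded, which reduces the
  minimization to a compact set.\<close>

lemma quadratic_growth_attains_inf:
  fixes H :: "'a::euclidean_space \<Rightarrow> real"
  assumes K: "closed K" "k \<in> K" and cont: "continuous_on UNIV H" and mu: "\<mu> > 0"
    and growth: "\<And>x. a + \<mu> * (norm (x - c))\<^sup>2 \<le> H x"
  obtains x where "x \<in> K" "\<And>y. y \<in> K \<Longrightarrow> H x \<le> H y"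
proof -
  define T where "T = K \<inter> {x. H x \<le> H k}"
  have "norm (x - c) \<le> sqrt ((H k - a) / \<mu>)" if "H x \<le> H k" for x
    using growth[of x] that mu by (intro real_le_rsqrt) (simp add: field_simps)
  then have "T \<subseteq> cball c (sqrt ((H k - a) / \<mu>))"
    by (auto simp: T_def dist_norm norm_minus_commute)
  then have "compact T"
    using K(1) cont bounded_subset[OF bounded_cball]
    by (auto simp: T_def compact_eq_bounded_closed
        intro!: closed_Int closed_Collect_le continuous_on_const)
  moreover have "T \<noteq> {}" using K(2) by (auto simp: T_def)
  ultimately obtain x where "x \<in> T" "\<And>y. y \<in> T \<Longrightarrow> H x \<le> H y"
    using continuous_attains_inf[of T H] continuous_on_subset[OF cont] by blast
  then show thesis
    by (intro that[of x]) (auto simp: T_def, smt (verit))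
qed

section \<open>The fast gradient method\<close>

text \<open>
  \<open>y, x, v\<close> are the current iterate, the extrapolated point and the estimate-sequence point
  \<open>x + (x - y)/q\<close>; the momentum coefficient of the method is what makes the next
  estimate-sequence point equal to \<open>(1 - q) v + q x - (q/m) g x\<close>.
\<close>

lemma fgm_energy_step:
  fixes \<phi> :: "'a::real_inner \<Rightarrow> real"
  assumes m: "m > 0" and q: "0 < q" "q \<le> 1" and M: "m = q\<^sup>2 * M"
    and y: "0 \<le> bregman \<phi> g y x" and u: "m / 2 * (norm (u - x))\<^sup>2 \<le> bregman \<phi> g u x"
    and y': "y' = x - (1 / M) *\<^sub>R g x"
    and descent: "bregman \<phi> g y' x \<le> M / 2 * (norm (y' - x))\<^sup>2"
    and v: "v = x + (1 / q) *\<^sub>R (x - y)" and v': "v' = y + (1 / q) *\<^sub>R (y' - y)"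
  shows "\<phi> y' - \<phi> u + m / 2 * (norm (v' - u))\<^sup>2
    \<le> (1 - q) * (\<phi> y - \<phi> u + m / 2 * (norm (v - u))\<^sup>2)"
proof -
  have M0: "M > 0" using m M q by (simp add: zero_less_mult_iff)
  define h where "h = g x"
  \<comment> \<open>The next estimate-sequence point before its gradient correction.\<close>
  define p where "p = (1 - q) *\<^sub>R v + q *\<^sub>R x"
  have qM: "1 / (q * M) = q / m" using M q M0 by (simp add: power2_eq_square)
  have p_alt: "p = y + (1 / q) *\<^sub>R (x - y)"
  proof -
    have "(1 - q) *\<^sub>R v + q *\<^sub>R x = x + ((1 - q) / q) *\<^sub>R (x - y)"
      by (simp add: v algebra_simps)
    also have "(1 - q) / q = 1 / q - 1" using q by (simp add: field_simps)
    finally show ?thesis by (simp add: p_def algebra_simps)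
  qed
  have v'_alt: "v' = p - (q / m) *\<^sub>R h"
    unfolding v' p_alt y' qM[symmetric] by (simp add: h_def algebra_simps)
  \<comment> \<open>Splits the slope term into the parts absorbed by the tangent bounds at
    \<open>u\<close> (weight \<open>q\<close>) and at \<open>y\<close> (weight
    \<open>1 - q\<close>).\<close>
  have hp: "q * (h \<bullet> (p - u)) = q * (h \<bullet> (x - u)) + (1 - q) * (h \<bullet> (x - y))"
  proof -
    have "q *\<^sub>R (p - u) = q *\<^sub>R (x - u) + (1 - q) *\<^sub>R (x - y)"
      unfolding p_alt using q by (simp add: algebra_simps)
    then have "h \<bullet> (q *\<^sub>R (p - u)) = h \<bullet> (q *\<^sub>R (x - u) + (1 - q) *\<^sub>R (x - y))" by simp
    then show ?thesis by (simp add: inner_add_right)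
  qed
  have desc: "\<phi> y' \<le> \<phi> x - 1 / (2 * M) * (norm h)\<^sup>2"
  proof -
    have "y' - x = - (1 / M) *\<^sub>R h" by (simp add: y' h_def)
    then have "h \<bullet> (y' - x) = - (1 / M) * (norm h)\<^sup>2" "norm (y' - x) = 1 / M * norm h"
      using M0 by (simp_all add: power2_norm_eq_inner)
    then have "\<phi> y' \<le> \<phi> x - 1 / M * (norm h)\<^sup>2 + M / 2 * (1 / M * norm h)\<^sup>2"
      using descent by (simp add: bregman_def flip: h_def)
    also have "M / 2 * (1 / M * norm h)\<^sup>2 = 1 / (2 * M) * (norm h)\<^sup>2"
      using M0 by (simp add: power2_eq_square)
    finally show ?thesis by simp
  qed
  have "m / 2 * (norm (v' - u))\<^sup>2
      = m / 2 * (norm (p - u))\<^sup>2 - q * (h \<bullet> (p - u)) + q\<^sup>2 / (2 * m) * (norm h)\<^sup>2"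
  proof -
    have "v' - u = (p - u) - (q / m) *\<^sub>R h" by (simp add: v'_alt)
    then have "(norm (v' - u))\<^sup>2
        = (norm (p - u))\<^sup>2 - 2 * (q / m) * ((p - u) \<bullet> h) + (q / m)\<^sup>2 * (norm h)\<^sup>2"
      by (simp only: norm_diff_scaleR_squared)
    then show ?thesis
      using m by (simp only: inner_commute[of h]) (simp add: power2_eq_square field_simps)
  qed
  also have "q\<^sup>2 / (2 * m) = 1 / (2 * M)" using M q M0 by simp
  finally have vu: "m / 2 * (norm (v' - u))\<^sup>2
      = m / 2 * (norm (p - u))\<^sup>2 - q * (h \<bullet> (p - u)) + 1 / (2 * M) * (norm h)\<^sup>2" .
  have "(norm (p - u))\<^sup>2 \<le> (1 - q) * (norm (v - u))\<^sup>2 + q * (norm (x - u))\<^sup>2"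
  proof -
    have pu: "p - u = (1 - q) *\<^sub>R (v - u) + q *\<^sub>R (x - u)"
      by (simp add: p_def algebra_simps)
    have "(norm (p - u))\<^sup>2 = (1 - q) * (norm (v - u))\<^sup>2 + q * (norm (x - u))\<^sup>2
        - q * (1 - q) * (norm ((v - u) - (x - u)))\<^sup>2"
      unfolding pu by (rule norm_convex_combination_squared)
    moreover have "0 \<le> q * (1 - q) * (norm ((v - u) - (x - u)))\<^sup>2" using q by simp
    ultimately show ?thesis by linarith
  qed
  then have "m / 2 * (norm (p - u))\<^sup>2
      \<le> m / 2 * ((1 - q) * (norm (v - u))\<^sup>2 + q * (norm (x - u))\<^sup>2)"
    using m by (intro mult_left_mono) auto
  then have pu: "m / 2 * (norm (p - u))\<^sup>2
      \<le> (1 - q) * (m / 2 * (norm (v - u))\<^sup>2) + q * (m / 2 * (norm (x - u))\<^sup>2)"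
    by (simp only: distrib_left mult_ac)
  have "q * (\<phi> x - h \<bullet> (x - u) + m / 2 * (norm (x - u))\<^sup>2) \<le> q * \<phi> u"
    using u q by (intro mult_left_mono)
      (auto simp: bregman_def h_def norm_minus_commute inner_diff_right)
  then have qu: "q * \<phi> x - q * (h \<bullet> (x - u)) + q * (m / 2 * (norm (x - u))\<^sup>2) \<le> q * \<phi> u"
    by (simp only: distrib_left right_diff_distrib)
  have "(1 - q) * (\<phi> x - h \<bullet> (x - y)) \<le> (1 - q) * \<phi> y"
    using y q by (intro mult_left_mono) (auto simp: bregman_def h_def inner_diff_right)
  then have qy: "(1 - q) * \<phi> x - (1 - q) * (h \<bullet> (x - y)) \<le> (1 - q) * \<phi> y"
    by (simp only: right_diff_distrib)
  have "\<phi> y' - \<phi> u + m / 2 * (norm (v' - u))\<^sup>2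
      \<le> (1 - q) * \<phi> y - \<phi> u + q * \<phi> u + (1 - q) * (m / 2 * (norm (v - u))\<^sup>2)"
    using desc vu pu hp qu qy left_diff_distrib[of 1 q "\<phi> x"] by linarith
  then show ?thesis by (simp add: algebra_simps)
qed

text \<open>Gradients lie in \<open>V\<close>, hence so do all iterates, and strong convexity on
  \<open>V\<close> feeds the energy step. The energy \<open>En\<close> contracts by
  \<open>1 - q\<close> with \<open>q = sqrt (m / M)\<close>.\<close>

lemma fgm_linear_rate:
  fixes \<phi> :: "'a::real_inner \<Rightarrow> real" and y yt :: "nat \<Rightarrow> 'a"
  assumes V: "subspace V" and g: "\<And>x. g x \<in> V"
    and m: "0 < m" "m \<le> M"
    and sc: "\<And>x w. x \<in> V \<Longrightarrow> w \<in> V \<Longrightarrow> m / 2 * (norm (w - x))\<^sup>2 \<le> bregman \<phi> g w x"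
    and sm: "\<And>x w. bregman \<phi> g w x \<le> M / 2 * (norm (w - x))\<^sup>2"
    and init: "y 0 = 0" "yt 0 = 0"
    and y: "\<And>k. y (Suc k) = yt k - (1 / M) *\<^sub>R g (yt k)"
    and yt: "\<And>k. yt (Suc k) = y (Suc k) +
      ((sqrt M - sqrt m) / (sqrt M + sqrt m)) *\<^sub>R (y (Suc k) - y k)"
    and u: "u \<in> V"
  shows "y k \<in> V"
    and "\<phi> (y k) - \<phi> u \<le> (1 - sqrt (m / M)) ^ k * (\<phi> 0 - \<phi> u + m / 2 * (norm u)\<^sup>2)"
proof -
  have "y k \<in> V \<and> yt k \<in> V" for k
    by (induction k)
      (auto simp: init y yt intro!: subspace_add[OF V] subspace_diff[OF V] subspace_scale[OF V]
         subspace_0[OF V] g)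
  then have yV: "y k \<in> V" and ytV: "yt k \<in> V" for k by auto
  show "y k \<in> V" by (rule yV)
  define q where "q = sqrt (m / M)"
  have q: "0 < q" "q \<le> 1" and mM: "m = q\<^sup>2 * M"
    using m by (auto simp: q_def)
  have \<beta>: "(sqrt M - sqrt m) / (sqrt M + sqrt m) = (1 - q) / (1 + q)"
  proof -
    have "sqrt m = q * sqrt M" using m by (simp add: q_def real_sqrt_divide)
    then have "(sqrt M - sqrt m) / (sqrt M + sqrt m) = (sqrt M * (1 - q)) / (sqrt M * (1 + q))"
      by (simp add: algebra_simps)
    then show ?thesis using m by simp
  qed
  define v where "v k = yt k + (1 / q) *\<^sub>R (yt k - y k)" for k
  have v_Suc: "v (Suc k) = y k + (1 / q) *\<^sub>R (y (Suc k) - y k)" for k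
  proof -
    define b where "b = (1 - q) / (1 + q)"
    define d where "d = y (Suc k) - y k"
    \<comment> \<open>This identity makes the extrapolation reproduce the recursion of the estimate
      sequence.\<close>
    have b: "b + b / q = 1 / q - 1"
    proof -
      have "b * (1 + q) = 1 - q" using q by (simp add: b_def)
      moreover have "b + b / q = b * (1 + q) / q" using q by (simp add: field_simps)
      ultimately show ?thesis using q by (simp add: diff_divide_distrib)
    qed
    have "v (Suc k) = y k + d + (b + b / q) *\<^sub>R d"
      by (simp add: v_def yt \<beta> flip: b_def d_def) (simp add: d_def algebra_simps)
    then show ?thesis by (simp add: b d_def algebra_simps)
  qed
  define En where "En k = \<phi> (y k) - \<phi> u + m / 2 * (norm (v k - u))\<^sup>2" for k
  have step: "En (Suc k) \<le> (1 - q) * En k" for k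
    unfolding En_def
  proof (rule fgm_energy_step[OF m(1) q mM, where g = g and x = "yt k"])
    show "0 \<le> bregman \<phi> g (y k) (yt k)"
      using sc[OF ytV[of k] yV[of k]] m by (smt (verit) zero_le_power2 mult_nonneg_nonneg divide_nonneg_pos)
  qed (rule sc[OF ytV u] y sm v_def v_Suc)+
  have "En k \<le> (1 - q) ^ k * En 0"
  proof (induction k)
    case (Suc k)
    have "En (Suc k) \<le> (1 - q) * ((1 - q) ^ k * En 0)"
      using step[of k] mult_left_mono[OF Suc, of "1 - q"] q by linarith
    then show ?case by (simp add: mult.assoc)
  qed simp
  moreover have "\<phi> (y k) - \<phi> u \<le> En k" using m by (simp add: En_def)
  moreover have "En 0 = \<phi> 0 - \<phi> u + m / 2 * (norm u)\<^sup>2"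
    by (simp add: En_def v_def init)
  ultimately show "\<phi> (y k) - \<phi> u
      \<le> (1 - sqrt (m / M)) ^ k * (\<phi> 0 - \<phi> u + m / 2 * (norm u)\<^sup>2)"
    by (simp add: q_def)
qed

text \<open>Here \<open>x\<close> stands for the condition number and \<open>\<kappa>\<close> for
  \<open>L/\<mu>\<close>. The decay is at most \<open>exp (- N/s)\<close>, and
  \<open>s \<le> 2 G\<close> turns the constant 50 of the iteration bound into the exponent 25 of
  \<open>exp 1 + G\<close>.\<close>

lemma fgm_rate_numeric:
  assumes \<kappa>: "0 \<le> \<kappa>" and x: "1 \<le> x"
    and N: "real N \<ge> soft_O_bound (sqrt (max 1 \<kappa> * x))"
  shows "(1 - 1 / sqrt (x * (\<kappa> + 1))) ^ N * (\<kappa> + 1) \<le> 1 / (32 * x * (\<kappa> + 1)\<^sup>2)"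
proof -
  define k where "k = max 1 \<kappa>"
  define G where "G = sqrt (k * x)"
  define s where "s = sqrt (x * (\<kappa> + 1))"
  have k: "1 \<le> k" "\<kappa> + 1 \<le> 2 * k" using \<kappa> by (auto simp: k_def)
  have G2: "G\<^sup>2 = k * x" using k x by (simp add: G_def)
  have G1: "1 \<le> G" using k(1) x mult_mono[of 1 k 1 x] by (simp add: G_def)
  have s1: "1 \<le> s" using \<kappa> x mult_mono[of 1 x 1 "\<kappa> + 1"] by (simp add: s_def)
  have sG: "s \<le> 2 * G"
  proof -
    have "x * (\<kappa> + 1) \<le> 4 * (k * x)" using k x mult_mono[of "\<kappa> + 1" "4 * k" x x] \<kappa> by simp
    then have "s \<le> sqrt (4 * (k * x))" by (simp add: s_def)
    then show ?thesis by (simp only: G_def real_sqrt_mult) simp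
  qed
  have e2: "2 \<le> exp (1::real)" using exp_ge_add_one_self[of 1] by simp
  then have ln0: "0 \<le> ln (exp 1 + G)" using G1 by (intro ln_ge_zero) linarith
  have "25 * ln (exp 1 + G) * s \<le> 25 * ln (exp 1 + G) * (2 * G)"
    using sG ln0 by (intro mult_left_mono) auto
  also have "\<dots> \<le> real N" using N by (simp add: soft_O_bound_def G_def k_def mult_ac)
  finally have N25: "25 * ln (exp 1 + G) \<le> real N / s" using s1 by (simp add: field_simps)
  have "(1 - 1 / s) ^ N \<le> exp (- (1 / s)) ^ N"
    using s1 exp_ge_add_one_self[of "- (1 / s)"] by (intro power_mono) auto
  also have "\<dots> = exp (- (real N / s))" by (simp add: exp_of_nat_mult[symmetric])
  also have "\<dots> \<le> exp (- (25 * ln (exp 1 + G)))" using N25 by simp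
  also have "\<dots> = 1 / (exp 1 + G) ^ 25"
    using G1 e2 by (simp add: exp_minus exp_of_nat_mult[of 25, simplified] inverse_eq_divide)
  also have "\<dots> \<le> 1 / (32 * x * (\<kappa> + 1) ^ 3)"
  proof (rule divide_left_mono)
    \<comment> \<open>The target is at most \<open>2^8 G^6\<close>; both 2 and \<open>G\<close> are
      below \<open>exp 1 + G\<close>, so its exponent is 14, within 25.\<close>
    have "32 * x * (\<kappa> + 1) ^ 3 \<le> 32 * x * (2 * k) ^ 3"
      using x k \<kappa> by (intro mult_left_mono power_mono) auto
    also have "\<dots> \<le> 256 * x ^ 3 * k ^ 3"
      using x k power_increasing[of 1 3 x] by (simp add: power_mult_distrib)
    also have "\<dots> = 2 ^ 8 * (G\<^sup>2) ^ 3" by (simp add: G2 power_mult_distrib)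
    also have "\<dots> \<le> (exp 1 + G) ^ 8 * (exp 1 + G) ^ 6"
      unfolding power_mult[symmetric] using G1 e2 by (intro mult_mono power_mono) auto
    also have "\<dots> \<le> (exp 1 + G) ^ 25"
      unfolding power_add[symmetric] using G1 e2 by (intro power_increasing) auto
    finally show "32 * x * (\<kappa> + 1) ^ 3 \<le> (exp 1 + G) ^ 25" .
    show "0 < (exp 1 + G) ^ 25 * (32 * x * (\<kappa> + 1) ^ 3)"
      using \<kappa> x G1 e2 by (intro mult_pos_pos zero_less_power) auto
  qed simp
  finally have "(1 - 1 / s) ^ N * (\<kappa> + 1) \<le> 1 / (32 * x * (\<kappa> + 1) ^ 3) * (\<kappa> + 1)"
    using \<kappa> by (intro mult_right_mono) auto
  also have "\<dots> = 1 / (32 * x * (\<kappa> + 1)\<^sup>2)"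
    using \<kappa> x by (simp add: power2_eq_square power3_eq_cube)
  finally show ?thesis by (simp add: s_def)
qed

section \<open>Symmetric matrices and their square roots\<close>

lemma symmetric_matrix_inner:
  fixes A :: "real^'n^'n"
  assumes "transpose A = A"
  shows "(A *v x) \<bullet> y = x \<bullet> (A *v y)"
  by (metis assms dot_lmul_matrix vector_transpose_matrix)

text \<open>Eigenvectors for distinct eigenvalues are orthogonal, hence independent. This makes
  \<open>Max\<close> and \<open>Min\<close> over the spectrum meaningful.\<close>

lemma finite_eigenvalues_if_symmetric:
  fixes A :: "real^'n::finite^'n"
  assumes "transpose A = A"
  shows "finite {l. eigenvalue A l}"
proof -
  have "\<forall>l. \<exists>v. eigenvalue A l \<longrightarrow> v \<noteq> 0 \<and> A *v v = l *\<^sub>R v"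
    by (auto simp: eigenvalue_def)
  from choice[OF this] obtain v
    where v: "\<And>l. eigenvalue A l \<Longrightarrow> v l \<noteq> 0 \<and> A *v v l = l *\<^sub>R v l"
    by blast
  have orth: "v l \<bullet> v k = 0" if "eigenvalue A l" "eigenvalue A k" "l \<noteq> k" for l k
    using symmetric_matrix_inner[OF assms, of "v l" "v k"] v[OF that(1)] v[OF that(2)] that(3)
    by simp
  have "inj_on v {l. eigenvalue A l}"
    by (rule inj_onI) (metis mem_Collect_eq orth v inner_eq_zero_iff)
  moreover have "pairwise orthogonal (v ` {l. eigenvalue A l})"
    by (auto simp: pairwise_def orthogonal_def) (metis orth)
  then have "independent (v ` {l. eigenvalue A l})"
    by (rule pairwise_orthogonal_independent) (use v in auto)
  then have "finite (v ` {l. eigenvalue A l})"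
    by (rule finiteI_independent)
  ultimately show ?thesis using finite_imageD by blast
qed

text \<open>The Rayleigh quotient attains its minimum on the unit sphere of \<open>V\<close>.
  Invariance keeps the residual \<open>B v\<close> of the minimizer in \<open>V\<close>, where it is
  an admissible variation.\<close>

lemma rayleigh_min_on_invariant_subspace:
  fixes A :: "real^'n::finite^'n"
  assumes sym: "transpose A = A" and V: "subspace V" "V \<noteq> {0}"
    and inv: "\<And>x. x \<in> V \<Longrightarrow> A *v x \<in> V"
  obtains v l where "v \<in> V" "v \<noteq> 0" "A *v v = l *\<^sub>R v"
    "\<And>x. x \<in> V \<Longrightarrow> l * (norm x)\<^sup>2 \<le> x \<bullet> (A *v x)"
proof -
  let ?T = "V \<inter> sphere 0 1"
  obtain w where "w \<in> V" "w \<noteq> 0" using V subspace_0[OF V(1)] by auto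
  then have "(1 / norm w) *\<^sub>R w \<in> ?T" using subspace_scale[OF V(1)] by simp
  moreover have "compact ?T" by (intro closed_Int_compact closed_subspace V) simp
  moreover have "continuous_on ?T (\<lambda>x. x \<bullet> (A *v x))"
    by (intro continuous_intros)
  ultimately obtain v where v: "v \<in> ?T" "\<And>x. x \<in> ?T \<Longrightarrow> v \<bullet> (A *v v) \<le> x \<bullet> (A *v x)"
    using continuous_attains_inf[of ?T] by blast
  define l where "l = v \<bullet> (A *v v)"
  have ray: "l * (norm x)\<^sup>2 \<le> x \<bullet> (A *v x)" if "x \<in> V" for x
  proof (cases "x = 0")
    case False
    have "(1 / norm x) *\<^sub>R x \<in> ?T" using that False subspace_scale[OF V(1)] by simp
    from v(2)[OF this] have "l \<le> (x \<bullet> (A *v x)) / (norm x)\<^sup>2"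
      by (simp add: l_def matrix_vector_mult_scaleR power2_eq_square)
    then show ?thesis using False by (simp add: field_simps)
  qed simp
  define B where "B x = A *v x - l *\<^sub>R x" for x
  have vB: "v \<bullet> B v = 0"
    using v(1) by (simp add: B_def l_def inner_diff_right power2_norm_eq_inner[symmetric])
  have B_nonneg: "0 \<le> x \<bullet> B x" if "x \<in> V" for x
    using ray[OF that] by (simp add: B_def inner_diff_right power2_norm_eq_inner)
  have Bsym: "x \<bullet> B y = B x \<bullet> y" for x y
    by (simp add: B_def inner_diff_left inner_diff_right symmetric_matrix_inner[OF sym])
  have Blin: "B (x + t *\<^sub>R y) = B x + t *\<^sub>R B y" for x y t
    by (simp add: B_def matrix_vector_right_distrib matrix_vector_mult_scaleR algebra_simps)
  \<comment> \<open>\<open>B\<close> is positive semidefinite on \<open>V\<close> and its quadratic form vanishes at \<open>v\<close>.\<close>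
  have "B v = 0"
  proof -
    define b where "b = B v \<bullet> B v"
    define d where "d = B v \<bullet> B (B v)"
    have BvV: "B v \<in> V"
      using v(1) inv V(1) by (auto simp: B_def intro!: subspace_diff subspace_scale)
    \<comment> \<open>A quadratic without constant term stays nonnegative only if its linear
      coefficient vanishes.\<close>
    have quad: "0 \<le> 2 * t * b + t\<^sup>2 * d" for t
    proof -
      have "0 \<le> (v + t *\<^sub>R B v) \<bullet> B (v + t *\<^sub>R B v)"
        using v(1) BvV V(1) by (intro B_nonneg subspace_add subspace_scale) auto
      also have "\<dots> = 2 * t * b + t\<^sup>2 * d"
        by (simp add: Blin inner_add_left inner_add_right vB[unfolded inner_commute[of v]] Bsym[of v]
            b_def d_def power2_eq_square distrib_left)
      finally show ?thesis .
    qed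
    have d: "0 \<le> d" using B_nonneg[OF BvV] by (simp add: d_def)
    \<comment> \<open>Adding 1 keeps the step \<open>- b / e\<close> meaningful when
      \<open>d = 0\<close>.\<close>
    define e where "e = d + 1"
    have e: "0 < e" "d \<le> e" using d by (auto simp: e_def)
    have "0 \<le> 2 * (- b / e) * b + (- b / e)\<^sup>2 * d" by (rule quad)
    also have "\<dots> \<le> 2 * (- b / e) * b + (- b / e)\<^sup>2 * e"
      using e by (intro add_left_mono mult_left_mono) auto
    also have "\<dots> = - (b\<^sup>2 / e)"
      using e by (simp add: power2_eq_square)
    finally have "b = 0" using e by (simp add: divide_le_0_iff)
    then show ?thesis by (simp add: b_def)
  qed
  then show thesis
    using v(1) ray by (intro that[of v l]) (auto simp: B_def)
qed

lemma psd_sqrt_symmetric: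
  assumes "is_psd_sqrt S A"
  shows "transpose S = S" "transpose A = A"
proof -
  show S: "transpose S = S" using assms by (simp add: is_psd_sqrt_def)
  then show "transpose A = A"
    using assms by (metis is_psd_sqrt_def matrix_transpose_mul)
qed

lemma psd_sqrt_mult: "is_psd_sqrt S A \<Longrightarrow> S *v (S *v x) = A *v x"
  by (simp add: is_psd_sqrt_def matrix_vector_mul_assoc)

lemma psd_sqrt_norm:
  fixes A :: "real^'n::finite^'n"
  assumes "is_psd_sqrt S A"
  shows "(norm (S *v x))\<^sup>2 = x \<bullet> (A *v x)"
  using symmetric_matrix_inner[OF psd_sqrt_symmetric(1)[OF assms], of x "S *v x"]
  by (simp add: power2_norm_eq_inner psd_sqrt_mult[OF assms])

text \<open>For symmetric \<open>S\<close> the kernel is the orthogonal complement of the range. The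
  range component of a preimage is again a preimage, the other component being in the
  kernel.\<close>

lemma range_symmetric_matrix:
  fixes S :: "real^'n::finite^'n"
  assumes sym: "transpose S = S" and v: "\<And>k. S *v k = 0 \<Longrightarrow> v \<bullet> k = 0"
  obtains u where "u \<in> range ((*v) S)" "S *v u = v"
proof -
  have sub: "subspace (range ((*v) S))"
    by (intro linear_subspace_image) auto
  have "(range ((*v) S))\<^sup>\<bottom> = {k. S *v k = 0}"
    using ker_orthogonal_comp_adjoint[of "(*v) S"] sym
    by (auto simp: adjoint_matrix)
  then have "v \<in> (range ((*v) S))\<^sup>\<bottom>\<^sup>\<bottom>"
    using v by (auto simp: orthogonal_comp_def orthogonal_def inner_commute)
  then obtain w where w: "v = S *v w" using orthogonal_comp_self[OF sub] by auto
  obtain a b where a: "a \<in> range ((*v) S)" and wab: "w = a + b"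
      and b: "\<And>x. x \<in> range ((*v) S) \<Longrightarrow> orthogonal b x"
    using orthogonal_subspace_decomp_exists[of "range ((*v) S)" w] span_eq_iff sub by metis
  have "(S *v b) \<bullet> (S *v b) = b \<bullet> (S *v (S *v b))"
    by (rule symmetric_matrix_inner[OF sym])
  also have "\<dots> = 0" using b by (auto simp: orthogonal_def)
  finally have "S *v a = v" by (simp add: w wab matrix_vector_right_distrib)
  with a that show thesis by blast
qed

text \<open>The lower bound comes from the Rayleigh minimum on the range of \<open>S\<close>, the
  upper one from the same minimum for \<open>- A\<close> on the whole space.\<close>

lemma sqrt_spectral_bounds:
  fixes A :: "real^'n::finite^'n"
  assumes S: "is_psd_sqrt S A" and "S \<noteq> 0"
  shows "0 < lambda_min_nz A" and "lambda_min_nz A \<le> lambda_max A"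
    and "(norm (S *v x))\<^sup>2 \<le> lambda_max A * (norm x)\<^sup>2"
    and "y \<in> range ((*v) S) \<Longrightarrow> lambda_min_nz A * (norm y)\<^sup>2 \<le> (norm (S *v y))\<^sup>2"
proof -
  note sym = psd_sqrt_symmetric[OF S]
  have fin: "finite {l. eigenvalue A l}" "finite {l. eigenvalue A l \<and> l \<noteq> 0}"
    using finite_eigenvalues_if_symmetric[OF sym(2)] by auto
  have nonneg: "0 \<le> l" if "eigenvalue A l" for l
  proof -
    from that obtain v where v: "v \<noteq> 0" "A *v v = l *\<^sub>R v" by (auto simp: eigenvalue_def)
    then have "0 \<le> l * (norm v)\<^sup>2"
      using psd_sqrt_norm[OF S, of v] by (metis inner_scaleR_right power2_norm_eq_inner zero_le_power2)
    then show ?thesis using v by (simp add: zero_le_mult_iff)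
  qed
  have sub: "subspace (range ((*v) S))" by (intro linear_subspace_image) auto
  have "range ((*v) S) \<noteq> {0}"
    using \<open>S \<noteq> 0\<close> matrix_eq[of S 0] by auto
  moreover have "A *v x \<in> range ((*v) S)" for x
    by (metis psd_sqrt_mult[OF S] rangeI)
  ultimately obtain v l where v: "v \<in> range ((*v) S)" "v \<noteq> 0" "A *v v = l *\<^sub>R v"
    and ray: "\<And>x. x \<in> range ((*v) S) \<Longrightarrow> l * (norm x)\<^sup>2 \<le> x \<bullet> (A *v x)"
    using rayleigh_min_on_invariant_subspace[OF sym(2) sub] by metis
  \<comment> \<open>A vector of the range annihilated by \<open>S\<close> is orthogonal to
    itself.\<close>
  have "l \<noteq> 0"
  proof
    assume "l = 0"
    then have "S *v v = 0" using psd_sqrt_norm[OF S, of v] v by simp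
    moreover obtain w where "v = S *v w" using v by blast
    ultimately have "v \<bullet> v = 0"
      using symmetric_matrix_inner[OF sym(1), of w v] by simp
    then show False using v by simp
  qed
  with v have l: "eigenvalue A l \<and> l \<noteq> 0" by (auto simp: eigenvalue_def)
  then have min: "lambda_min_nz A \<in> {l. eigenvalue A l \<and> l \<noteq> 0}" "lambda_min_nz A \<le> l"
    unfolding lambda_min_nz_def using fin Min_in[of "{l. eigenvalue A l \<and> l \<noteq> 0}"] by auto
  then show "0 < lambda_min_nz A" using nonneg[of "lambda_min_nz A"] by auto
  show "lambda_min_nz A \<le> lambda_max A"
    unfolding lambda_max_def using min fin by auto
  show "lambda_min_nz A * (norm y)\<^sup>2 \<le> (norm (S *v y))\<^sup>2" if "y \<in> range ((*v) S)"
  proof -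
    have "lambda_min_nz A * (norm y)\<^sup>2 \<le> l * (norm y)\<^sup>2"
      using min by (intro mult_right_mono) auto
    then show ?thesis using ray[OF that] by (simp add: psd_sqrt_norm[OF S])
  qed
  have neg: "(- A) *v x = - (A *v x)" for x
    by (simp add: matrix_vector_mult_def vec_eq_iff sum_negf)
  have "transpose (- A) = - A" using sym(2) by (simp add: transpose_def vec_eq_iff)
  then obtain w k where w: "w \<noteq> 0" "(- A) *v w = k *\<^sub>R w"
    and rayk: "\<And>x. k * (norm x)\<^sup>2 \<le> x \<bullet> ((- A) *v x)"
    using rayleigh_min_on_invariant_subspace[of "- A" UNIV] v(2) by (metis UNIV_I subspace_UNIV UNIV_eq_I singletonD)
  have "A *v w = (- k) *\<^sub>R w" using w(2) unfolding neg by (metis minus_minus scaleR_minus_left)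
  then have "eigenvalue A (- k)" using w(1) by (auto simp: eigenvalue_def)
  then have "- k \<le> lambda_max A" unfolding lambda_max_def using fin by auto
  then have "(- k) * (norm x)\<^sup>2 \<le> lambda_max A * (norm x)\<^sup>2" by (intro mult_right_mono) auto
  then show "(norm (S *v x))\<^sup>2 \<le> lambda_max A * (norm x)\<^sup>2"
    using rayk[of x] by (simp add: neg psd_sqrt_norm[OF S])
qed

section \<open>Block structure\<close>

lemma block_stack [simp]: "block (stack v) i = v i"
  by (simp add: block_def stack_def vec_eq_iff)

lemma stack_eq_iff: "stack v = x \<longleftrightarrow> (\<forall>i. v i = block x i)"
  by (auto simp: block_def stack_def vec_eq_iff)

lemma block_diff: "block (x - y) i = block x i - block y i"
  and block_add: "block (x + y) i = block x i + block y i"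
  and block_scaleR: "block (a *\<^sub>R x) i = a *\<^sub>R block x i"
  and block_zero: "block 0 i = 0"
  by (simp_all add: block_def vec_eq_iff)

lemma inner_eq_sum_block: "x \<bullet> y = (\<Sum>i\<in>UNIV. block x i \<bullet> block y i)"
  by (simp add: inner_vec_def block_def sum.cartesian_product case_prod_unfold flip: UNIV_Times_UNIV)

lemma mult_block: "block (W *v x) i = (\<Sum>j\<in>UNIV. mat_block W i j *v block x j)"
  by (simp add: vec_eq_iff block_def mat_block_def matrix_vector_mult_def sum.cartesian_product
      case_prod_unfold flip: UNIV_Times_UNIV)

text \<open>The objective is a sum of independent block problems, so the local oracles form an
  oracle for the regularized function.\<close>

lemma primal_point_stack:
  fixes f :: "'m::finite \<Rightarrow> real^'n::finite \<Rightarrow> real"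
  assumes "\<And>j. is_primal_point (regularize \<mu> (block c j) (f j)) (block w j) (p j)"
  shows "is_primal_point (regularize \<mu> c (separable_sum f)) w (stack p)"
proof -
  have "w \<bullet> x - regularize \<mu> c (separable_sum f) x
      = (\<Sum>j\<in>UNIV. block w j \<bullet> block x j - regularize \<mu> (block c j) (f j) (block x j))" for x
    by (simp add: regularize_def separable_sum_def power2_norm_eq_inner inner_eq_sum_block
        block_diff sum_subtractf sum.distrib sum_distrib_left)
  moreover have "block w j \<bullet> y - regularize \<mu> (block c j) (f j) y
      \<le> block w j \<bullet> p j - regularize \<mu> (block c j) (f j) (p j)" for j y
    using assms[of j] by (auto simp: is_primal_point_def is_arg_max_linorder)
  ultimately show ?thesis
    by (auto simp: is_primal_point_def is_arg_max_linorder intro!: sum_mono)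
qed

section \<open>The dual problem\<close>

lemma bregman_dual:
  fixes S :: "real^'n::finite^'n"
  assumes "transpose S = S"
  shows "bregman (\<lambda>y. conjugate_via H X (S *v y)) (\<lambda>y. S *v X (S *v y)) y x
    = bregman (conjugate_via H X) X (S *v y) (S *v x)"
  by (simp add: bregman_def symmetric_matrix_inner[OF assms] matrix_vector_mult_diff_distrib)

text \<open>Iterates of the method before the change of variables \<open>z = S y\<close>.\<close>

primrec centralized_fgm ::
  "real^'n::finite^'n \<Rightarrow> (real^'n \<Rightarrow> real^'n) \<Rightarrow> real \<Rightarrow> real \<Rightarrow> nat \<Rightarrow> (real^'n) \<times> (real^'n)" where
  "centralized_fgm S X M m 0 = (0, 0)"
| "centralized_fgm S X M m (Suc k) =
     (let y = fst (centralized_fgm S X M m k);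
          yt = snd (centralized_fgm S X M m k);
          y' = yt - (1 / M) *\<^sub>R (S *v X (S *v yt))
      in (y', y' + ((sqrt M - sqrt m) / (sqrt M + sqrt m)) *\<^sub>R (y' - y)))"

text \<open>Applying \<open>S\<close> to the centralized recursion turns \<open>S X\<close> into
  \<open>S S X = W X\<close>, whose blocks are the sums computed by the nodes.\<close>

lemma dual_fgm_eq_centralized:
  fixes orc :: "'m::finite \<Rightarrow> real^'n::finite \<Rightarrow> real^'n"
  assumes S: "is_psd_sqrt S W"
  defines "X \<equiv> \<lambda>w. stack (\<lambda>j. orc j (block w j))"
  shows "fst (dual_fgm W orc M m k) = block (S *v fst (centralized_fgm S X M m k))
    \<and> snd (dual_fgm W orc M m k) = block (S *v snd (centralized_fgm S X M m k))"
proof (induction k)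
  case 0
  then show ?case by (simp add: block_zero fun_eq_iff)
next
  case (Suc k)
  have "(\<Sum>j\<in>UNIV. mat_block W i j *v orc j (block w j)) = block (S *v (S *v X w)) i" for i w
    by (simp add: psd_sqrt_mult[OF S] mult_block X_def)
  then show ?case
    using Suc by (simp add: Let_def fun_eq_iff block_diff block_add block_scaleR
        matrix_vector_mult_diff_distrib matrix_vector_right_distrib matrix_vector_mult_scaleR)
qed

text \<open>At a minimizer over the kernel the gradient is orthogonal to the kernel;
  \<open>u\<close> is a Lagrange multiplier.\<close>

lemma gradient_in_range_at_constrained_minimizer:
  fixes S :: "real^'n::finite^'n"
  assumes sym: "transpose S = S" and M: "M > 0"
    and sm: "\<And>y. bregman H G y x \<le> M / 2 * (norm (y - x))\<^sup>2"
    and x: "S *v x = 0" "\<And>y. S *v y = 0 \<Longrightarrow> H x \<le> H y"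
  obtains u where "u \<in> range ((*v) S)" "S *v u = G x"
proof -
  have "subspace {k. S *v k = 0}"
    by (simp add: subspace_def matrix_vector_right_distrib matrix_vector_mult_scaleR)
  then have "G x \<bullet> k = 0" if "S *v k = 0" for k
    using that x M sm gradient_orthogonal_at_minimizer[of "{k. S *v k = 0}" M H G x k]
    by (auto simp: matrix_vector_right_distrib)
  then show thesis
    using range_symmetric_matrix[OF sym] that by metis
qed

text \<open>A Lagrange multiplier of the primal solution is a dual minimizer; taken in the range of
  \<open>S\<close>, its norm is controlled by the gradient, and \<open>ystar\<close> is no longer
  than it.\<close>

lemma smallest_dual_minimizer_bound:
  fixes S :: "real^'n::finite^'n"
  assumes S: "is_psd_sqrt S W" "S \<noteq> 0" and M: "M > 0"
    and sm: "\<And>y. bregman F g y x \<le> M / 2 * (norm (y - x))\<^sup>2"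
    and conv: "\<And>y. 0 \<le> bregman F g y x"
    and x: "is_solution F S x"
    and ystar: "is_arg_min norm (is_arg_min (dual_fun F S) (\<lambda>_. True)) ystar"
  shows "lambda_min_nz W * (norm ystar)\<^sup>2 \<le> (norm (g x))\<^sup>2"
proof -
  note sym = psd_sqrt_symmetric(1)[OF S(1)]
  have Sx: "S *v x = 0" and min: "\<And>y. S *v y = 0 \<Longrightarrow> F x \<le> F y"
    using x by (auto simp: is_solution_def is_arg_min_linorder)
  obtain u where u: "u \<in> range ((*v) S)" "S *v u = g x"
    using gradient_in_range_at_constrained_minimizer[OF sym M sm Sx min] .
  have Sx0: "(S *v y) \<bullet> x = 0" for y
    by (simp add: symmetric_matrix_inner[OF sym] Sx)
  have "dual_fun F S u \<le> ereal (- F x)"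
    unfolding dual_fun_def
  proof (rule SUP_least)
    fix y
    have "(S *v u) \<bullet> y - F y \<le> (S *v u) \<bullet> x - F x"
      using primal_point_if_gradient[OF conv u(2)[symmetric]] by (simp add: is_primal_point_iff)
    then show "ereal ((S *v u) \<bullet> y - F y) \<le> ereal (- F x)" by (simp add: Sx0)
  qed
  \<comment> \<open>Weak duality: the feasible \<open>x\<close> competes in the supremum.\<close>
  moreover have "ereal (- F x) \<le> dual_fun F S y" for y
    unfolding dual_fun_def by (rule SUP_upper2[of x]) (auto simp: Sx0)
  ultimately have "is_arg_min (dual_fun F S) (\<lambda>_. True) u"
    unfolding is_arg_min_linorder by (blast intro: order_trans)
  then have "norm ystar \<le> norm u" using ystar by (auto simp: is_arg_min_linorder)
  then have "lambda_min_nz W * (norm ystar)\<^sup>2 \<le> lambda_min_nz W * (norm u)\<^sup>2"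
    using sqrt_spectral_bounds(1)[OF S] by (intro mult_left_mono power_mono) auto
  also have "\<dots> \<le> (norm (g x))\<^sup>2"
    using sqrt_spectral_bounds(4)[OF S u(1)] u(2) by simp
  finally show ?thesis .
qed

theorem theorem4p4:
  fixes E :: "('m::finite \<times> 'm) set"
    and f :: "'m \<Rightarrow> real^'n::finite \<Rightarrow> real"
    and F :: "real^('m \<times> 'n) \<Rightarrow> real"
    and W S :: "real^('m \<times> 'n)^('m \<times> 'n)"
    and c xstar ystar :: "real^('m \<times> 'n)"
    and orc :: "'m \<Rightarrow> real^'n \<Rightarrow> real^'n"
    and z :: "nat \<Rightarrow> real^('m \<times> 'n)"
    and L \<epsilon> R Rx \<mu> L\<phi> \<mu>\<phi> :: real
    and N :: nat
  assumes graph: "simple_graph E" "connected_graph E"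
    and W: "W = kronecker (laplacian E) (mat 1)"
    and S: "is_psd_sqrt S W"
    and f_convex: "\<And>i. convex_on UNIV (f i)"
    and F: "F = separable_sum f"
    and F_convex: "convex_on UNIV F"
    and F_smooth: "L_smooth L F"
    and eps: "\<epsilon> > 0"
    and c: "is_primal_point F 0 c"
    and xstar: "is_arg_min (\<lambda>x. norm (x - c)) (is_solution F S) xstar"
    and Rx: "Rx = norm (xstar - c)" "Rx > 0"
    and ystar: "is_arg_min norm (is_arg_min (dual_fun F S) (\<lambda>_. True)) ystar"
    and R: "R = norm ystar"
    and mu: "\<mu> = \<epsilon> / Rx\<^sup>2"
    and dual_friendly: "\<And>j w. is_primal_point (regularize \<mu> (block c j) (f j)) w (orc j w)"
    and L\<phi>: "L\<phi> = lambda_max W / \<mu>"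
    and \<mu>\<phi>: "\<mu>\<phi> = lambda_min_nz W / (L + \<mu>)"
    and z: "\<And>k. z k = stack (fst (dual_fgm W orc L\<phi> \<mu>\<phi> k))"
    and N: "real N \<ge> soft_O_bound (sqrt (max 1 (L * Rx\<^sup>2 / \<epsilon>) * cond_number W))"
  shows "(\<exists>!xN. is_primal_point (regularize \<mu> c F) (z N) xN) \<and>
    (\<forall>xN. is_primal_point (regularize \<mu> c F) (z N) xN \<longrightarrow>
        approx_optimal F S xstar \<epsilon> (ereal \<epsilon> / ereal R) xN)"
proof -
  obtain g where g: "\<And>x. GDERIV F x :> g x" and lip: "\<And>x y. norm (g x - g y) \<le> L * norm (x - y)"
    using F_smooth by (auto simp: L_smooth_def)
  \<comment> \<open>The points \<open>xstar\<close> and \<open>c\<close> are distinct, so the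
    Lipschitz bound between them fixes the sign of \<open>L\<close>.\<close>
  have L0: "0 \<le> L"
  proof -
    have "0 \<le> L * norm (xstar - c)" using lip[of xstar c] norm_ge_zero order_trans by blast
    then show ?thesis using Rx by (simp add: zero_le_mult_iff)
  qed
  have mu0: "0 < \<mu>" using eps Rx(2) by (simp add: mu)
  define M where "M = L + \<mu>"
  have M: "0 < M" "L \<le> M" "\<mu> \<le> M" using L0 mu0 by (auto simp: M_def)
  have eps_eq: "\<epsilon> = \<mu> * Rx\<^sup>2" using Rx(2) by (simp add: mu)

  \<comment> \<open>Curvature of \<open>F\<close> and nondegeneracy of the constraint\<close>
  have F_conv: "0 \<le> bregman F g y x" for x y
    by (rule bregman_nonneg_if_convex[OF F_convex g])
  have F_sm: "bregman F g y x \<le> L / 2 * (norm (y - x))\<^sup>2" for x y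
    by (rule bregman_le_if_lipschitz_gradient[OF g lip])
  have F_smM: "bregman F g y x \<le> M / 2 * (norm (y - x))\<^sup>2" for x y
    by (rule order_trans[OF F_sm]) (use M in \<open>auto intro: mult_right_mono\<close>)
  have gc: "g c = 0" by (rule gradient_at_primal_point[OF M(1) F_smM c])
  have c_min: "F c \<le> F y" for y using c by (simp add: is_primal_point_iff)
  have sol: "is_solution F S xstar"
    and closest: "\<And>y. is_solution F S y \<Longrightarrow> norm (xstar - c) \<le> norm (y - c)"
    using xstar by (auto simp: is_arg_min_linorder)
  then have Sxs: "S *v xstar = 0"
    by (auto simp: is_solution_def is_arg_min_linorder)
  \<comment> \<open>Otherwise the unconstrained minimizer \<open>c\<close> would be feasible,
    contradicting \<open>Rx > 0\<close>.\<close>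
  have "S \<noteq> 0"
  proof
    assume "S = 0"
    then have "is_solution F S c" using c_min by (simp add: is_solution_def is_arg_min_linorder)
    then show False using closest Rx by fastforce
  qed
  note sym = psd_sqrt_symmetric(1)[OF S] and spec = sqrt_spectral_bounds[OF S \<open>S \<noteq> 0\<close>]
  define l where "l = lambda_min_nz W"
  define h where "h = lambda_max W"
  have lh: "0 < l" "l \<le> h" using spec(1,2) by (simp_all add: l_def h_def)

  \<comment> \<open>The regularized function and its oracle\<close>
  define H where "H = regularize \<mu> c F"
  define G where "G x = g x + \<mu> *\<^sub>R (x - c)" for x
  have H_sc: "\<mu> / 2 * (norm (y - x))\<^sup>2 \<le> bregman H G y x" for x y
    using F_conv[of y x] by (simp add: H_def G_def[abs_def] regularize_bregman)
  have H_sm: "bregman H G y x \<le> M / 2 * (norm (y - x))\<^sup>2" for x y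
    using F_sm[of y x] by (simp add: H_def G_def[abs_def] regularize_bregman M_def distrib_right add_divide_distrib)
  have H_conv: "0 \<le> bregman H G y x" for x y
    by (rule order_trans[OF _ H_sc]) (use mu0 in simp)
  define X where "X w = stack (\<lambda>j. orc j (block w j))" for w
  have X: "is_primal_point H w (X w)" for w
    unfolding H_def F X_def using dual_friendly by (intro primal_point_stack) auto
  have GX: "G (X w) = w" for w by (rule gradient_at_primal_point[OF M(1) H_sm X])
  have X_unique: "x = X w" if "is_primal_point H w x" for w x
    by (rule primal_point_unique[OF mu0 H_sc GX that])
  have FH: "F x \<le> H x" for x using mu0 by (simp add: H_def regularize_def)
  \<comment> \<open>The choice of \<open>\<mu>\<close> makes the penalty at \<open>xstar\<close>
    exactly half the tolerance.\<close>
  have Hxs: "H xstar = F xstar + \<epsilon> / 2"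
    by (simp add: H_def regularize_def eps_eq flip: Rx(1))
  have "H c \<le> H x" for x
    using order_trans[OF c_min FH] by (simp add: H_def regularize_def)
  then have X0: "X 0 = c"
    by (intro X_unique[symmetric]) (simp add: is_primal_point_iff)

  \<comment> \<open>The regularized dual function\<close>
  define \<phi> where "\<phi> y = conjugate_via H X (S *v y)" for y
  define gr where "gr y = S *v X (S *v y)" for y
  note breg = bregman_dual[OF sym, of H X, folded \<phi>_def gr_def]
  have h\<phi>: "L\<phi> = h / \<mu>" and l\<phi>: "\<mu>\<phi> = l / M"
    by (simp_all add: L\<phi> \<mu>\<phi> h_def l_def M_def)
  have pos: "0 < \<mu>\<phi>" "\<mu>\<phi> \<le> L\<phi>"
    unfolding h\<phi> l\<phi> using lh M mu0 by (auto intro: frac_le)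
  have \<phi>_sm: "bregman \<phi> gr y x \<le> L\<phi> / 2 * (norm (y - x))\<^sup>2" for x y
  proof -
    have "bregman \<phi> gr y x \<le> 1 / (2 * \<mu>) * (norm (S *v (y - x)))\<^sup>2"
      unfolding breg matrix_vector_mult_diff_distrib by (rule conjugate_smooth[OF mu0 H_sc GX])
    also have "\<dots> \<le> 1 / (2 * \<mu>) * (h * (norm (y - x))\<^sup>2)"
      using mu0 spec(3) by (intro mult_left_mono) (auto simp: h_def)
    finally show ?thesis by (simp add: h\<phi>)
  qed
  let ?V = "range ((*v) S)"
  have V: "subspace ?V" by (intro linear_subspace_image) auto
  have \<phi>_conj: "1 / (2 * M) * (norm (S *v (y - x)))\<^sup>2 \<le> bregman \<phi> gr y x" for x y
    unfolding breg matrix_vector_mult_diff_distrib by (rule conjugate_strongly_convex[OF M(1) H_sm X])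
  \<comment> \<open>The lower spectral bound of \<open>S\<close> confines this estimate to its
    range.\<close>
  have \<phi>_sc: "\<mu>\<phi> / 2 * (norm (y - x))\<^sup>2 \<le> bregman \<phi> gr y x" if "x \<in> ?V" "y \<in> ?V" for x y
  proof -
    have "\<mu>\<phi> / 2 * (norm (y - x))\<^sup>2 = 1 / (2 * M) * (l * (norm (y - x))\<^sup>2)"
      by (simp add: l\<phi>)
    also have "\<dots> \<le> 1 / (2 * M) * (norm (S *v (y - x)))\<^sup>2"
      using M spec(4)[OF subspace_diff[OF V that(2,1)]] by (intro mult_left_mono) (auto simp: l_def)
    finally show ?thesis using \<phi>_conj[of y x] by linarith
  qed
  have \<phi>_conv: "0 \<le> bregman \<phi> gr y x" for x y
    by (rule order_trans[OF _ \<phi>_conj]) (use M in simp)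

  \<comment> \<open>Solutions of the regularized primal and dual problems\<close>
  have "continuous_on UNIV H"
  proof -
    have "continuous_on UNIV F"
      using has_derivative_continuous[OF g[unfolded gderiv_def]]
      by (intro continuous_at_imp_continuous_on) simp
    then show ?thesis unfolding H_def regularize_def[abs_def] by (intro continuous_intros)
  qed
  moreover have "closed {x. S *v x = 0}"
    by (intro closed_Collect_eq continuous_intros) 
  moreover have "F c + \<mu> / 2 * (norm (x - c))\<^sup>2 \<le> H x" for x
    using c_min by (simp add: H_def regularize_def)
  ultimately obtain xm where xm: "S *v xm = 0" and xm_min: "\<And>y. S *v y = 0 \<Longrightarrow> H xm \<le> H y"
    using quadratic_growth_attains_inf[of "{x. S *v x = 0}" xstar H "\<mu> / 2" "F c" c] Sxs mu0
    by auto
  obtain u where uV: "u \<in> ?V" and Su: "S *v u = G xm"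
    using gradient_in_range_at_constrained_minimizer[OF sym M(1) H_sm xm xm_min] .
  \<comment> \<open>As \<open>u\<close> is a multiplier for \<open>xm\<close>, the dual gradient
    vanishes at \<open>u\<close> and strong duality holds there.\<close>
  have "X (S *v u) = xm"
    by (rule X_unique[symmetric], rule primal_point_if_gradient[OF H_conv Su[symmetric]])
  then have gru: "gr u = 0" and \<phi>u: "\<phi> u = - H xm"
    by (simp_all add: gr_def \<phi>_def conjugate_via_def xm symmetric_matrix_inner[OF sym])
  have u_min: "\<phi> u \<le> \<phi> y" for y using \<phi>_conv[of y u] by (simp add: bregman_def gru)

  \<comment> \<open>Conditioning and initial dual gap\<close>
  define K where "K = L / \<mu> + 1"
  have K: "1 \<le> K" "M = K * \<mu>" using L0 mu0 by (simp_all add: K_def M_def field_simps)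
  define \<chi>W where "\<chi>W = cond_number W"
  have \<chi>W: "\<chi>W = h / l" "1 \<le> \<chi>W"
    using lh by (simp_all add: \<chi>W_def cond_number_def h_def l_def)

  have gap0: "\<phi> 0 - \<phi> u \<le> K * \<epsilon> / 2"
  proof -
    have "\<phi> 0 = - F c" by (simp add: \<phi>_def conjugate_via_def X0 H_def regularize_def)
    moreover have "F xstar \<le> F c + L / 2 * Rx\<^sup>2"
      using F_sm[of xstar c] by (simp add: bregman_def gc Rx(1))
    moreover have "L / 2 * Rx\<^sup>2 + \<epsilon> / 2 = K * \<epsilon> / 2"
      using mu0 by (simp add: K_def eps_eq field_simps)
    ultimately show ?thesis using xm_min[OF Sxs] Hxs \<phi>u by linarith
  qed
  \<comment> \<open>Strong convexity at the stationary \<open>u\<close>; it caps the initial energy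
    at twice the gap, hence at \<open>K * \<epsilon>\<close>.\<close>
  have u_norm: "\<mu>\<phi> / 2 * (norm u)\<^sup>2 \<le> \<phi> 0 - \<phi> u"
    using \<phi>_sc[OF uV subspace_0[OF V]] by (simp add: bregman_def gru)

  \<comment> \<open>Dual gap after \<open>N\<close> iterations\<close>
  define Y where "Y = centralized_fgm S X L\<phi> \<mu>\<phi>"
  define y where "y = fst (Y N)"
  have zy: "z N = S *v y"
    using dual_fgm_eq_centralized[OF S, of orc L\<phi> \<mu>\<phi> N]
    by (simp add: z y_def Y_def X_def[abs_def] stack_eq_iff)
  have grV: "gr x \<in> ?V" for x by (simp add: gr_def)
  have yV: "y \<in> ?V"
    and rate: "\<phi> y - \<phi> u
      \<le> (1 - sqrt (\<mu>\<phi> / L\<phi>)) ^ N * (\<phi> 0 - \<phi> u + \<mu>\<phi> / 2 * (norm u)\<^sup>2)"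
    unfolding y_def
    by (rule fgm_linear_rate[where g = gr and yt = "\<lambda>k. snd (Y k)", OF V grV pos \<phi>_sc \<phi>_sm _ _ _ _ uV];
        simp add: Y_def Let_def gr_def)+
  define \<delta> where "\<delta> = \<phi> y - \<phi> u"
  have \<delta>0: "0 \<le> \<delta>" using u_min by (simp add: \<delta>_def)
  \<comment> \<open>Calibrated so that inserting this bound in \<open>2 * L\<phi> * \<delta>\<close>
    gives the square of \<open>\<epsilon> / (4 * K * a)\<close>.\<close>
  have \<delta>: "\<delta> \<le> \<epsilon> / (32 * \<chi>W * K\<^sup>2)"
  proof -
    have q: "sqrt (\<mu>\<phi> / L\<phi>) = 1 / sqrt (\<chi>W * (L / \<mu> + 1))"
    proof -
      have "\<mu>\<phi> / L\<phi> = 1 / (\<chi>W * K)"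
        unfolding h\<phi> l\<phi> \<chi>W(1) K(2) using lh mu0 K(1) by (simp add: field_simps)
      then show ?thesis by (simp add: K_def real_sqrt_divide)
    qed
    have "sqrt (\<mu>\<phi> / L\<phi>) \<le> 1" using pos by simp
    then have "\<delta> \<le> (1 - sqrt (\<mu>\<phi> / L\<phi>)) ^ N * (K * \<epsilon>)"
      unfolding \<delta>_def using gap0 u_norm
      by (intro order_trans[OF rate] mult_left_mono zero_le_power) auto
    also have "\<dots> = (1 - 1 / sqrt (\<chi>W * (L / \<mu> + 1))) ^ N * (L / \<mu> + 1) * \<epsilon>"
      by (simp add: q K_def)
    also have "\<dots> \<le> 1 / (32 * \<chi>W * (L / \<mu> + 1)\<^sup>2) * \<epsilon>"
    proof (intro mult_right_mono fgm_rate_numeric \<chi>W)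
      have "L * Rx\<^sup>2 / \<epsilon> = L / \<mu>" using Rx(2) mu0 by (simp add: eps_eq)
      then show "soft_O_bound (sqrt (max 1 (L / \<mu>) * \<chi>W)) \<le> real N"
        using N by (simp add: \<chi>W_def)
    qed (use L0 mu0 eps in auto)
    finally show ?thesis by (simp add: K_def)
  qed

  \<comment> \<open>\<open>K a\<close> is a common scale for \<open>R\<close>, \<open>\<parallel>u\<parallel>\<close> and \<open>\<parallel>y - u\<parallel>\<close>, matched to \<open>\<parallel>gr y\<parallel> \<le> \<epsilon>/(4 K a)\<close>.\<close>
  define a where "a = sqrt (\<epsilon> * \<mu> / l)"
  have a: "0 < a" "a\<^sup>2 = \<epsilon> * \<mu> / l" using eps mu0 lh by (simp_all add: a_def)
  have norm_le: "norm v \<le> K * a" if "\<mu>\<phi> / 2 * (norm v)\<^sup>2 \<le> K * \<epsilon> / 2" for v :: "real^('m \<times> 'n)"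
  proof -
    have "(norm v)\<^sup>2 \<le> K * \<epsilon> * M / l"
      using that lh M by (simp add: l\<phi> field_simps)
    also have "\<dots> = (K * a)\<^sup>2"
      unfolding power_mult_distrib a(2) K(2) by (simp add: power2_eq_square)
    finally show ?thesis by (rule power2_le_imp_le) (use K a in simp)
  qed
  have y_norm: "norm y \<le> 2 * K * a"
  proof -
    \<comment> \<open>The final gap is below the a priori bound \<open>K * \<epsilon> / 2\<close>,
      so \<open>y - u\<close> obeys the same estimate as \<open>u\<close>.\<close>
    have "\<epsilon> / (32 * \<chi>W * K\<^sup>2) \<le> \<epsilon> / 2"
      using eps K \<chi>W(2) mult_mono[of 1 \<chi>W 1 "K\<^sup>2"] by (intro divide_left_mono) auto
    also have "\<dots> \<le> K * \<epsilon> / 2" using eps K by simp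
    finally have "norm (y - u) \<le> K * a"
      using \<phi>_sc[OF uV yV] \<delta> by (intro norm_le) (simp add: bregman_def gru \<delta>_def)
    moreover have "norm u \<le> K * a" using u_norm gap0 by (intro norm_le) linarith
    ultimately show ?thesis using norm_triangle_sub[of y u] by linarith
  qed
  have res: "norm (gr y) \<le> \<epsilon> / (4 * K * a)"
  proof -
    have L\<phi>0: "0 < L\<phi>" using pos by simp
    \<comment> \<open>One gradient step from \<open>y\<close> lowers \<open>\<phi>\<close> by at
      least \<open>\<parallel>gr y\<parallel>^2 / (2 L\<phi>)\<close>, which cannot exceed the
      gap.\<close>
    define w where "w = y - (1 / L\<phi>) *\<^sub>R gr y"
    have "\<phi> w \<le> \<phi> y - (norm (gr y))\<^sup>2 / L\<phi> + L\<phi> / 2 * (norm (gr y) / L\<phi>)\<^sup>2"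
      using \<phi>_sm[of w y] L\<phi>0 by (simp add: bregman_def w_def power2_norm_eq_inner)
    also have "L\<phi> / 2 * (norm (gr y) / L\<phi>)\<^sup>2 = (norm (gr y))\<^sup>2 / L\<phi> / 2"
      using L\<phi>0 by (simp add: power2_eq_square)
    finally have "(norm (gr y))\<^sup>2 / L\<phi> / 2 \<le> \<delta>" using u_min[of w] by (simp add: \<delta>_def)
    then have "(norm (gr y))\<^sup>2 \<le> 2 * L\<phi> * \<delta>"
      using L\<phi>0 by (simp add: pos_divide_le_eq mult_ac)
    also have "\<dots> \<le> 2 * L\<phi> * (\<epsilon> / (32 * \<chi>W * K\<^sup>2))"
      using \<delta> L\<phi>0 by (intro mult_left_mono) auto
    also have "\<dots> = (\<epsilon> / (4 * K * a))\<^sup>2"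
      unfolding power_divide power_mult_distrib a(2) h\<phi> \<chi>W(1)
      using lh mu0 K(1) eps by (simp add: power2_eq_square)
    finally show ?thesis by (rule power2_le_imp_le) (use K a eps in simp)
  qed
  have R_le: "R \<le> K * a"
  proof -
    \<comment> \<open>Since \<open>g c = 0\<close>, the Lipschitz bound controls the gradient at
      \<open>xstar\<close> and, through it, the smallest dual solution of the unregularized
      problem.\<close>
    have "norm (g xstar) \<le> L * Rx" using lip[of xstar c] by (simp add: gc Rx(1))
    also have "\<dots> \<le> M * Rx" using M Rx(2) by (intro mult_right_mono) auto
    finally have "(norm (g xstar))\<^sup>2 \<le> (M * Rx)\<^sup>2" by (rule power_mono) simp
    then have "l * R\<^sup>2 \<le> (M * Rx)\<^sup>2"
      using smallest_dual_minimizer_bound[OF S \<open>S \<noteq> 0\<close> M(1) F_smM F_conv sol ystar]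
      by (simp add: R l_def)
    then have "R\<^sup>2 \<le> (M * Rx)\<^sup>2 / l" using lh by (simp add: field_simps)
    also have "\<dots> = (K * a)\<^sup>2"
      unfolding power_mult_distrib a(2) K(2) eps_eq by (simp add: power2_eq_square)
    finally show ?thesis by (rule power2_le_imp_le) (use K a in simp)
  qed

  \<comment> \<open>Optimality and feasibility of the final point\<close>
  have "approx_optimal F S xstar \<epsilon> (ereal \<epsilon> / ereal R) (X (z N))"
    unfolding approx_optimal_def
  proof
    have "\<phi> y = y \<bullet> gr y - H (X (z N))"
      by (simp add: \<phi>_def conjugate_via_def zy gr_def symmetric_matrix_inner[OF sym])
    \<comment> \<open>The dual term and the regularization error contribute
      \<open>\<epsilon> / 2\<close> each.\<close>
    then have "F (X (z N)) \<le> y \<bullet> gr y + H xm"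
      using FH[of "X (z N)"] u_min[of y] \<phi>u by linarith
    also have "H xm \<le> F xstar + \<epsilon> / 2" using xm_min[OF Sxs] Hxs by simp
    also have "y \<bullet> gr y \<le> norm y * norm (gr y)" by (rule norm_cauchy_schwarz)
    also have "\<dots> \<le> 2 * K * a * (\<epsilon> / (4 * K * a))"
      using y_norm res K a by (intro mult_mono) auto
    also have "\<dots> = \<epsilon> / 2" using K a by simp
    finally show "F (X (z N)) - F xstar \<le> \<epsilon>" by simp
    show "ereal (norm (S *v X (z N))) \<le> ereal \<epsilon> / ereal R"
    \<comment> \<open>For \<open>R = 0\<close> the extended-real tolerance is infinite.\<close>
    proof (cases "R = 0")
      case False
      then have R0: "0 < R" by (simp add: R)
      have "norm (gr y) * R \<le> \<epsilon> / (4 * K * a) * (K * a)"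
        using res R_le R0 K a eps by (intro mult_mono) auto
      also have "\<dots> \<le> \<epsilon>" using K a eps by simp
      finally show ?thesis using R0 by (simp add: zy gr_def field_simps)
    qed (use eps in simp)
  qed
  then show ?thesis
    using X X_unique unfolding H_def by metis
qed

end
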